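(* There are absolute constants $c>0$ and $C>0$ such that the following holds. Let $n,N$ be positive integers with $N\le n\cdot2^{c\log^*(n)}$ and let $A:[n]\times[n]\to[N]$ be a linjection. Then $$\alpha_3(A)\ \le\ C\,\frac{n^2}{2^{c\log^*(n)}} .$$
   Context: $[n]=\{1,\dots,n\}$; $\log^*$ is the iterated logarithm (base 2). A linjection $A:[n]\times[n]\to[N]$ (with $N\ge n$) is a map that is injective on every row $\{x\}\times[n]$ and every column $[n]\times\{y\}$. It corresponds to the function $f:[n]\times[n]\times[N]\to\{0,1\}$ with $f(x,y,b)=1\iff A(x,y)=b$. In $X_1\times X_2\times X_3=[n]\times[n]\times[N]$, a cylinder in dimension $i$ is a subset closed under arbitrary changes of the $i$-th coordinate, and a cylinder intersection is a set $T_1\cap T_2\cap T_3$ with $T_i$ a cylinder in dimension $i$. $\alpha_3(A)=\alpha_3(f)$ is the largest cardinality of a cylinder intersection contained in $f^{-1}(1)$. *)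

theory Defs
  imports Complex_Main "HOL-Library.FuncSet"
begin

(* The number of applications of the binary logarithm needed to reach a value at most 1.
   All iterates before the last one exceed 1, so the value of log at nonpositive arguments
   plays no role. *)
definition log_star :: "real \<Rightarrow> nat" where
  "log_star x = (LEAST k. (log 2 ^^ k) x \<le> 1)"

definition linjection :: "nat \<Rightarrow> nat \<Rightarrow> (nat \<times> nat \<Rightarrow> nat) \<Rightarrow> bool" where
  "linjection n N A \<longleftrightarrow>
     n \<le> N \<and>
     A \<in> {1..n} \<times> {1..n} \<rightarrow> {1..N} \<and>
     (\<forall>x\<in>{1..n}. inj_on A ({x} \<times> {1..n})) \<and>
     (\<forall>y\<in>{1..n}. inj_on A ({1..n} \<times> {y}))"

definition linjection_fun :: "(nat \<times> nat \<Rightarrow> nat) \<Rightarrow> nat \<times> nat \<times> nat \<Rightarrow> nat" where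
  "linjection_fun A = (\<lambda>(x, y, b). if A (x, y) = b then 1 else 0)"

definition cylinder1 :: "'a set \<Rightarrow> 'b set \<Rightarrow> 'c set \<Rightarrow> ('a \<times> 'b \<times> 'c) set \<Rightarrow> bool" where
  "cylinder1 X1 X2 X3 T \<longleftrightarrow>
     T \<subseteq> X1 \<times> X2 \<times> X3 \<and> (\<forall>x y z. (x, y, z) \<in> T \<longrightarrow> (\<forall>x'\<in>X1. (x', y, z) \<in> T))"

definition cylinder2 :: "'a set \<Rightarrow> 'b set \<Rightarrow> 'c set \<Rightarrow> ('a \<times> 'b \<times> 'c) set \<Rightarrow> bool" where
  "cylinder2 X1 X2 X3 T \<longleftrightarrow>
     T \<subseteq> X1 \<times> X2 \<times> X3 \<and> (\<forall>x y z. (x, y, z) \<in> T \<longrightarrow> (\<forall>y'\<in>X2. (x, y', z) \<in> T))"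

definition cylinder3 :: "'a set \<Rightarrow> 'b set \<Rightarrow> 'c set \<Rightarrow> ('a \<times> 'b \<times> 'c) set \<Rightarrow> bool" where
  "cylinder3 X1 X2 X3 T \<longleftrightarrow>
     T \<subseteq> X1 \<times> X2 \<times> X3 \<and> (\<forall>x y z. (x, y, z) \<in> T \<longrightarrow> (\<forall>z'\<in>X3. (x, y, z') \<in> T))"

definition cylinder_intersection ::
    "'a set \<Rightarrow> 'b set \<Rightarrow> 'c set \<Rightarrow> ('a \<times> 'b \<times> 'c) set \<Rightarrow> bool" where
  "cylinder_intersection X1 X2 X3 S \<longleftrightarrow>
     (\<exists>T1 T2 T3. cylinder1 X1 X2 X3 T1 \<and> cylinder2 X1 X2 X3 T2 \<and> cylinder3 X1 X2 X3 T3 \<and>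
        S = T1 \<inter> T2 \<inter> T3)"

(* For finite X1, X2, X3 the maximum is over a finite set, which is nonempty because the
   empty set is a cylinder intersection. *)
definition alpha3_fun ::
    "'a set \<Rightarrow> 'b set \<Rightarrow> 'c set \<Rightarrow> ('a \<times> 'b \<times> 'c \<Rightarrow> nat) \<Rightarrow> nat" where
  "alpha3_fun X1 X2 X3 f =
     Max {card S |S. cylinder_intersection X1 X2 X3 S \<and> S \<subseteq> {p \<in> X1 \<times> X2 \<times> X3. f p = 1}}"

definition alpha3 :: "nat \<Rightarrow> nat \<Rightarrow> (nat \<times> nat \<Rightarrow> nat) \<Rightarrow> nat" where
  "alpha3 n N A = alpha3_fun {1..n} {1..n} {1..N} (linjection_fun A)"

end

theory Submission
  imports Defs
begin

text \<open>A cylinder intersection inside the graph of a linjection is the set \<^term>\<open>M\<close> of all triangles of a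
  tripartite graph on \<open>X\<close>, \<open>Y\<close>, \<open>B\<close> in which each edge lies in exactly one triangle. The bound comes
  from the entropy-increment argument of Fox's triangle removal lemma, specialised to this situation.

  For \<open>S \<subseteq> B\<close>, colour \<open>x\<close> and \<open>y\<close> by their neighbourhoods in \<open>S\<close> and give each \<open>b\<close> its own colour. For each
  of the three bipartite graphs, sum the logarithm of the density of the colour cell over all edges;
  the total lies between \<open>3 |M| ln \<delta>\<close> and \<open>0\<close> if the three densities are at least \<open>\<delta>\<close>. Enlarge \<open>S\<close> to
  \<open>S'\<close> so that no further neighbourhood rectangle \<open>X\<^sub>b \<times> Y\<^sub>b\<close> covers much of any cell beyond
  what the rectangles of \<open>S'\<close> cover. As \<open>M\<close> contains all triangles, \<open>S'\<close> covers at most \<open>|S'| |X|\<close> edges.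
  If this is small compared to \<open>|M|\<close>, then one of the three sums grows by at least \<open>|M| / 192\<close>: otherwise
  there is a triangle \<open>(x, y, b)\<close> in whose cells the covered part, and the parts where the
  neighbourhoods of \<open>b\<close> lose half their density under refinement, are small, so that \<open>X\<^sub>b \<times> Y\<^sub>b\<close> would
  cover too much. There are at most \<open>O(ln (1/\<delta>))\<close> steps, and each costs two exponentials in \<open>|S|\<close>.\<close>

section \<open>Densities and entropy of a coloured set\<close>

text \<open>For \<open>E \<subseteq> \<Omega>\<close>, the conditional expectation of the indicator
  of \<open>E\<close> given the colour of \<open>w\<close>, under the uniform measure on
  \<open>\<Omega>\<close>. Division by zero makes it 0 on colours that do not occur.\<close>

definition dens :: "('w \<Rightarrow> 'c) \<Rightarrow> 'w set \<Rightarrow> 'w set \<Rightarrow> 'w \<Rightarrow> real" where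
  "dens F \<Omega> E w = real (card {v\<in>E. F v = F w}) / real (card {v\<in>\<Omega>. F v = F w})"

text \<open>A cell of size \<open>k\<close> and density \<open>d\<close> contributes
  \<open>k * d * ln d\<close>. This is a negated entropy, and convexity of \<open>t * ln t\<close>
  makes it grow under refinement.\<close>

definition ent :: "('w \<Rightarrow> 'c) \<Rightarrow> 'w set \<Rightarrow> 'w set \<Rightarrow> real" where
  "ent F \<Omega> E = (\<Sum>w\<in>E. ln (dens F \<Omega> E w))"

text \<open>It also expresses measurability: with \<open>G\<close> a real function or a membership
  test, \<open>G\<close> is constant on the cells of \<open>F\<close>.\<close>

definition refines_on :: "'w set \<Rightarrow> ('w \<Rightarrow> 'c) \<Rightarrow> ('w \<Rightarrow> 'd) \<Rightarrow> bool" where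
  "refines_on \<Omega> F G \<longleftrightarrow> (\<forall>v\<in>\<Omega>. \<forall>w\<in>\<Omega>. F v = F w \<longrightarrow> G v = G w)"

lemma dens_nonneg: "0 \<le> dens F \<Omega> E w"
  by (simp add: dens_def)

lemma dens_le_1:
  assumes "finite \<Omega>" "E \<subseteq> \<Omega>"
  shows "dens F \<Omega> E w \<le> 1"
proof -
  have "card {v\<in>E. F v = F w} \<le> card {v\<in>\<Omega>. F v = F w}"
    using assms by (intro card_mono) auto
  then show ?thesis
    unfolding dens_def by (auto simp: divide_le_eq_1)
qed

lemma dens_pos:
  assumes "finite \<Omega>" "E \<subseteq> \<Omega>" "w \<in> E"
  shows "0 < dens F \<Omega> E w"
proof -
  have "finite E" using assms finite_subset by auto
  then have "card {v\<in>E. F v = F w} > 0" "card {v\<in>\<Omega>. F v = F w} > 0"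
    using assms by (auto simp: card_gt_0_iff)
  then show ?thesis by (simp add: dens_def)
qed

lemma dens_cong: "F v = F w \<Longrightarrow> dens F \<Omega> E v = dens F \<Omega> E w"
  by (simp add: dens_def)

lemma refines_on_dens: "refines_on \<Omega> F (dens F \<Omega>' E)"
  unfolding refines_on_def by (blast intro: dens_cong)

lemma dens_eq_indicator:
  assumes "finite \<Omega>" "R \<subseteq> \<Omega>" "refines_on \<Omega> F (\<lambda>w. w \<in> R)" "v \<in> \<Omega>"
  shows "dens F \<Omega> R v = (if v \<in> R then 1 else 0)"
proof (cases "v \<in> R")
  case True
  then have "{u\<in>R. F u = F v} = {u\<in>\<Omega>. F u = F v}"
    using assms(2-4) unfolding refines_on_def by blast
  moreover have "card {u\<in>\<Omega>. F u = F v} > 0"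
    using assms by (auto simp: card_gt_0_iff)
  ultimately show ?thesis using True by (simp add: dens_def)
next
  case False
  then have "{u\<in>R. F u = F v} = {}"
    using assms(2-4) unfolding refines_on_def by blast
  then have "card {u\<in>R. F u = F v} = 0" by (metis card.empty)
  then show ?thesis using False unfolding dens_def by simp
qed

text \<open>Conditional expectation is self-adjoint: both sides sum, over the pairs in
  \<open>R \<times> E\<close> of equal colour, the value of \<open>g\<close> divided by the size of
  the common cell.\<close>

lemma sum_dens_swap:
  assumes "finite \<Omega>" "E \<subseteq> \<Omega>" "R \<subseteq> \<Omega>" "refines_on \<Omega> F g"
  shows "(\<Sum>w\<in>R. g w * dens F \<Omega> E w) = (\<Sum>v\<in>E. g v * dens F \<Omega> R v)"
proof -
  have fin: "finite E" "finite R" using assms finite_subset by auto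
  define k where "k w = real (card {v\<in>\<Omega>. F v = F w})" for w
  have "(\<Sum>w\<in>R. g w * dens F \<Omega> E w) = (\<Sum>w\<in>R. \<Sum>v\<in>E. if F v = F w then g w / k w else 0)"
    using fin by (intro sum.cong) (auto simp: dens_def k_def sum.If_cases Int_def)
  also have "\<dots> = (\<Sum>v\<in>E. \<Sum>w\<in>R. if F v = F w then g w / k w else 0)"
    by (rule sum.swap)
  also have "\<dots> = (\<Sum>v\<in>E. \<Sum>w\<in>R. if F w = F v then g v / k v else 0)"
  proof (intro sum.cong refl)
    fix v w assume "v \<in> E" "w \<in> R"
    then have "F v = F w \<Longrightarrow> g v = g w"
      using assms unfolding refines_on_def by blast
    moreover have "F v = F w \<Longrightarrow> k v = k w" by (simp add: k_def)
    ultimately show "(if F v = F w then g w / k w else 0) = (if F w = F v then g v / k v else 0)"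
      by auto
  qed
  also have "\<dots> = (\<Sum>v\<in>E. g v * dens F \<Omega> R v)"
    using fin by (intro sum.cong) (auto simp: dens_def k_def sum.If_cases Int_def)
  finally show ?thesis .
qed

lemma sum_dens:
  assumes "finite \<Omega>" "E \<subseteq> \<Omega>" "refines_on \<Omega> F g"
  shows "(\<Sum>w\<in>\<Omega>. g w * dens F \<Omega> E w) = (\<Sum>v\<in>E. g v)"
proof -
  have "dens F \<Omega> \<Omega> v = 1" if "v \<in> E" for v
    using dens_eq_indicator[of \<Omega> \<Omega> F v] assms that by (auto simp: refines_on_def)
  then show ?thesis
    using sum_dens_swap[of \<Omega> E \<Omega> F g] assms by simp
qed

section \<open>Gibbs' inequality and entropy gain under refinement\<close>

lemma ln_2_le: "ln (2::real) \<le> 5/6"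
proof -
  have "ln (2::real) = ln ((4/3) * (3/2))" by simp
  also have "\<dots> = ln (4/3) + ln (3/2)" by (rule ln_mult_pos) auto
  also have "\<dots> \<le> (4/3 - 1) + (3/2 - 1)" by (intro add_mono ln_le_minus_one) auto
  finally show ?thesis by simp
qed

lemma ent_nonpos:
  assumes "finite \<Omega>" "E \<subseteq> \<Omega>"
  shows "ent F \<Omega> E \<le> 0"
  unfolding ent_def
proof (rule sum_nonpos)
  fix w assume "w \<in> E"
  with assms show "ln (dens F \<Omega> E w) \<le> 0"
    using dens_le_1[of \<Omega> E F w] dens_pos[of \<Omega> E w F] by simp
qed

text \<open>Gibbs' inequality for unnormalised weights: \<open>ln t \<le> t - 1\<close> is applied
  to the quotient of \<open>W\<close> by the density, and \<open>sum_dens\<close> bounds the sum of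
  that quotient over \<open>E\<close>.\<close>

lemma ent_ge_gibbs:
  assumes fin: "finite \<Omega>" and sub: "E \<subseteq> \<Omega>" and W: "refines_on \<Omega> F W"
    and nn: "\<And>w. w \<in> \<Omega> \<Longrightarrow> 0 \<le> W w" and pos: "\<And>w. w \<in> E \<Longrightarrow> 0 < W w"
  shows "(\<Sum>w\<in>E. ln (W w)) + real (card E) - (\<Sum>w\<in>\<Omega>. W w) \<le> ent F \<Omega> E"
proof -
  let ?D = "dens F \<Omega> E"
  have "ln (W w) + 1 - W w / ?D w \<le> ln (?D w)" if "w \<in> E" for w
  proof -
    have p: "0 < W w" "0 < ?D w" using that pos dens_pos fin sub by metis+
    then have "ln (W w / ?D w) \<le> W w / ?D w - 1" by (intro ln_le_minus_one) simp
    then show ?thesis using p by (simp add: ln_div)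
  qed
  then have "(\<Sum>w\<in>E. ln (W w) + 1 - W w / ?D w) \<le> ent F \<Omega> E"
    unfolding ent_def by (rule sum_mono)
  moreover have "(\<Sum>w\<in>E. W w / ?D w) \<le> (\<Sum>w\<in>\<Omega>. W w)"
  proof -
    have "refines_on \<Omega> F (\<lambda>w. W w / ?D w)"
      using W refines_on_dens[of \<Omega> F \<Omega> E] unfolding refines_on_def by metis
    from sum_dens[OF fin sub this]
    have "(\<Sum>w\<in>E. W w / ?D w) = (\<Sum>w\<in>\<Omega>. W w / ?D w * ?D w)" by simp
    \<comment> \<open>Terms agree on cells that meet \<open>E\<close>; on other cells the left-hand
      term is 0, as the density vanishes there.\<close>
    also have "\<dots> \<le> (\<Sum>w\<in>\<Omega>. W w)" using nn by (intro sum_mono) auto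
    finally show ?thesis .
  qed
  ultimately show ?thesis by (simp add: sum.distrib sum_subtractf)
qed

lemma ent_ge_ln:
  assumes "finite \<Omega>" "E \<subseteq> \<Omega>" "0 < \<delta>" "\<delta> * real (card \<Omega>) \<le> real (card E)"
  shows "real (card E) * ln \<delta> \<le> ent F \<Omega> E"
  using ent_ge_gibbs[of \<Omega> E F "\<lambda>_. \<delta>"] assms by (simp add: refines_on_def mult.commute)

text \<open>Gibbs' inequality is applied with the old densities, halved on \<^term>\<open>R\<close>.\<close>

lemma ent_refine_gain:
  assumes fin: "finite \<Omega>" and sub: "E \<subseteq> \<Omega>" and R: "R \<subseteq> \<Omega>"
    and ref: "refines_on \<Omega> F F0" and meas: "refines_on \<Omega> F (\<lambda>w. w \<in> R)"
    and low: "real (card (E \<inter> R)) \<le> (\<Sum>w\<in>R. dens F0 \<Omega> E w) / 2"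
  shows "ent F0 \<Omega> E + 1/12 * (\<Sum>w\<in>R. dens F0 \<Omega> E w) \<le> ent F \<Omega> E"
proof -
  let ?D = "dens F0 \<Omega> E"
  let ?W = "\<lambda>w. if w \<in> R then ?D w / 2 else ?D w"
  have finE: "finite E" using fin sub finite_subset by auto
  have "refines_on \<Omega> F ?W"
    unfolding refines_on_def
  proof (intro ballI impI)
    fix v w assume vw: "v \<in> \<Omega>" "w \<in> \<Omega>" "F v = F w"
    then have "F0 v = F0 w" "v \<in> R \<longleftrightarrow> w \<in> R"
      using ref meas unfolding refines_on_def by blast+
    then show "?W v = ?W w" using dens_cong[of F0 v w \<Omega> E] by simp
  qed
  then have "(\<Sum>w\<in>E. ln (?W w)) + real (card E) - (\<Sum>w\<in>\<Omega>. ?W w) \<le> ent F \<Omega> E"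
    by (rule ent_ge_gibbs[OF fin sub]) (auto simp: dens_nonneg dens_pos[OF fin sub])
  moreover have "(\<Sum>w\<in>E. ln (?W w)) = ent F0 \<Omega> E - ln 2 * real (card (E \<inter> R))"
  proof -
    have "(\<Sum>w\<in>E. ln (?W w)) = (\<Sum>w\<in>E. ln (?D w) - (if w \<in> R then ln 2 else 0))"
    proof (intro sum.cong refl)
      fix w assume "w \<in> E"
      then have "0 < ?D w" by (rule dens_pos[OF fin sub])
      then show "ln (?W w) = ln (?D w) - (if w \<in> R then ln 2 else 0)" by (simp add: ln_div)
    qed
    also have "\<dots> = ent F0 \<Omega> E - ln 2 * real (card (E \<inter> R))"
      using finE by (simp add: sum_subtractf ent_def sum.If_cases mult.commute)
    finally show ?thesis .
  qed
  moreover have "(\<Sum>w\<in>\<Omega>. ?W w) = real (card E) - (\<Sum>w\<in>R. ?D w) / 2"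
  proof -
    have "(\<Sum>w\<in>\<Omega>. ?W w) = (\<Sum>w\<in>\<Omega>. ?D w - (if w \<in> R then ?D w / 2 else 0))"
      by (intro sum.cong) auto
    also have "\<dots> = (\<Sum>w\<in>\<Omega>. ?D w) - (\<Sum>w\<in>R. ?D w) / 2"
      using fin R by (simp add: sum_subtractf sum.If_cases Int_absorb1 sum_divide_distrib)
    also have "(\<Sum>w\<in>\<Omega>. ?D w) = real (card E)"
      using sum_dens[OF fin sub, of F0 "\<lambda>_. 1"] by (simp add: refines_on_def)
    finally show ?thesis .
  qed
  \<comment> \<open>Halving the weights costs \<open>ln 2\<close> per point of
    \<open>E \<inter> R\<close>, at most 5/12 of the sum over \<open>R\<close>, while the total mass
    drops by 1/2 of that sum; 1/12 remains.\<close>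
  moreover have "ln 2 * real (card (E \<inter> R)) \<le> 5/6 * ((\<Sum>w\<in>R. ?D w) / 2)"
    using low ln_2_le by (intro mult_mono) auto
  ultimately show ?thesis by linarith
qed

lemma ent_mono:
  assumes "finite \<Omega>" "E \<subseteq> \<Omega>" "refines_on \<Omega> F F0"
  shows "ent F0 \<Omega> E \<le> ent F \<Omega> E"
  using ent_refine_gain[OF assms(1,2) empty_subsetI assms(3)] by (simp add: refines_on_def)

text \<open>Each cell of density below \<open>t\<close> has at most a fraction \<open>t\<close> of
  its points in \<open>E\<close>; sum over these cells.\<close>

lemma card_low_dens_le:
  assumes fin: "finite \<Omega>" and sub: "E \<subseteq> \<Omega>" and t: "0 \<le> t"
  shows "real (card {w\<in>E. dens F \<Omega> E w < t}) \<le> t * real (card \<Omega>)"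
proof -
  let ?g = "\<lambda>w. if dens F \<Omega> E w < t then 1 else (0::real)"
  have finE: "finite E" using fin sub finite_subset by auto
  have "refines_on \<Omega> F ?g"
    using refines_on_dens[of \<Omega> F \<Omega> E] unfolding refines_on_def by metis
  from sum_dens[OF fin sub this]
  have "(\<Sum>w\<in>E. ?g w) = (\<Sum>w\<in>\<Omega>. ?g w * dens F \<Omega> E w)" by simp
  also have "\<dots> \<le> (\<Sum>w\<in>\<Omega>. t)" using t by (intro sum_mono) auto
  also have "\<dots> = t * real (card \<Omega>)" by simp
  finally show ?thesis using finE by (simp add: sum.If_cases Int_def)
qed

text \<open>Every nonempty cell contributes exactly 1, so the sum counts the colours that
  occur.\<close>

lemma sum_inverse_cell_card_le:
  assumes "finite \<Omega>" "finite K" "F ` \<Omega> \<subseteq> K"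
  shows "(\<Sum>w\<in>\<Omega>. 1 / real (card {v\<in>\<Omega>. F v = F w})) \<le> real (card K)"
proof -
  have "(\<Sum>w\<in>\<Omega>. 1 / real (card {v\<in>\<Omega>. F v = F w}))
      = (\<Sum>c\<in>F ` \<Omega>. \<Sum>w\<in>{w\<in>\<Omega>. F w = c}. 1 / real (card {v\<in>\<Omega>. F v = F w}))"
    using assms(1) by (rule sum.image_gen)
  also have "\<dots> = (\<Sum>c\<in>F ` \<Omega>. 1)"
  proof (intro sum.cong refl)
    fix c assume "c \<in> F ` \<Omega>"
    then have "card {v\<in>\<Omega>. F v = c} > 0" using assms(1) by (auto simp: card_gt_0_iff)
    then show "(\<Sum>w\<in>{w\<in>\<Omega>. F w = c}. 1 / real (card {v\<in>\<Omega>. F v = F w})) = 1"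
      by simp
  qed
  also have "\<dots> \<le> real (card K)" using assms by (simp add: card_mono)
  finally show ?thesis .
qed

text \<open>Among the supersets of \<open>S\<close> choose one maximising covered weight minus
  \<open>\<eta>\<close> per element. Comparison with \<open>S\<close> bounds its size; comparison
  with \<open>insert b S'\<close> shows that no \<open>b\<close> adds more than
  \<open>\<eta>\<close>.\<close>

lemma exists_saturated_superset:
  fixes w :: "'w \<Rightarrow> real" and Q :: "'b \<Rightarrow> 'w set"
  assumes fin: "finite \<Omega>" "finite B" and Q: "\<And>b. b \<in> B \<Longrightarrow> Q b \<subseteq> \<Omega>"
    and w: "\<And>v. v \<in> \<Omega> \<Longrightarrow> 0 \<le> w v" and S: "S \<subseteq> B" and eta: "0 < \<eta>"
  obtains S' where "S \<subseteq> S'" "S' \<subseteq> B" "\<eta> * (real (card S') - real (card S)) \<le> (\<Sum>v\<in>\<Omega>. w v)"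
    "\<And>b. b \<in> B \<Longrightarrow> (\<Sum>v\<in>Q b - (\<Union>s\<in>S'. Q s). w v) \<le> \<eta>"
proof -
  let ?U = "\<lambda>T. \<Union>s\<in>T. Q s"
  define g where "g T = (\<Sum>v\<in>?U T. w v) - \<eta> * real (card T)" for T
  let ?C = "{T. S \<subseteq> T \<and> T \<subseteq> B}"
  have finC: "finite (g ` ?C)" and ne: "g ` ?C \<noteq> {}"
    using fin(2) S by (auto intro: finite_subset[of _ "Pow B"])
  from Max_in[OF this] obtain S' where S': "S \<subseteq> S'" "S' \<subseteq> B" "g S' = Max (g ` ?C)" by auto
  have max: "g T \<le> g S'" if "S \<subseteq> T" "T \<subseteq> B" for T
    using Max_ge[OF finC, of "g T"] that S' by auto
  have U: "?U T \<subseteq> \<Omega>" if "T \<subseteq> B" for T using that Q by blast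
  have finU: "finite (?U T)" if "T \<subseteq> B" for T using U[OF that] fin(1) finite_subset by blast
  show ?thesis
  proof (rule that[OF S'(1,2)])
    have "0 \<le> (\<Sum>v\<in>?U S. w v)" using U[OF S] w by (intro sum_nonneg) auto
    moreover have "(\<Sum>v\<in>?U S'. w v) \<le> (\<Sum>v\<in>\<Omega>. w v)"
      using U[OF S'(2)] w fin by (intro sum_mono2) auto
    ultimately show "\<eta> * (real (card S') - real (card S)) \<le> (\<Sum>v\<in>\<Omega>. w v)"
      using max[of S] S unfolding g_def by (simp add: algebra_simps)
  next
    fix b assume b: "b \<in> B"
    let ?T = "insert b S'"
    have T: "S \<subseteq> ?T" "?T \<subseteq> B" using S' b by auto
    have "finite S'" using S'(2) fin(2) finite_subset by auto
    then have "real (card ?T) \<le> real (card S') + 1" by (simp add: card_insert_if)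
    then have "\<eta> * real (card ?T) \<le> \<eta> * (real (card S') + 1)" using eta by simp
    moreover have "(\<Sum>v\<in>?U ?T. w v) = (\<Sum>v\<in>Q b - ?U S'. w v) + (\<Sum>v\<in>?U S'. w v)"
    proof -
      have "?U ?T = (Q b - ?U S') \<union> ?U S'" by blast
      then have "(\<Sum>v\<in>?U ?T. w v) = (\<Sum>v\<in>(Q b - ?U S') \<union> ?U S'. w v)" by (rule arg_cong)
      also have "\<dots> = (\<Sum>v\<in>Q b - ?U S'. w v) + (\<Sum>v\<in>?U S'. w v)"
      proof (rule sum.union_disjoint)
        show "finite (Q b - ?U S')" using Q[OF b] fin(1) finite_subset by blast
      qed (use finU[OF S'(2)] in blast)+
      finally show ?thesis .
    qed
    ultimately show "(\<Sum>v\<in>Q b - ?U S'. w v) \<le> \<eta>"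
      using max[OF T] unfolding g_def by (simp add: algebra_simps)
  qed
qed

text \<open>\<open>R\<close> is a union of cells of \<open>F\<close>, so
  \<open>card (E \<inter> R)\<close> equals the sum of the new densities over \<open>R\<close>, at
  most half the sum of the old ones. That is the input of \<open>ent_refine_gain\<close>.\<close>

lemma ent_gain_low:
  assumes fin: "finite \<Omega>" and sub: "E \<subseteq> \<Omega>" and ref: "refines_on \<Omega> F F0"
    and R: "R = {w\<in>\<Omega>. dens F \<Omega> E w \<le> dens F0 \<Omega> E w / 2}"
  shows "ent F0 \<Omega> E + 1/12 * (\<Sum>w\<in>R. dens F0 \<Omega> E w) \<le> ent F \<Omega> E"
proof (rule ent_refine_gain[OF fin sub _ ref])
  show sR: "R \<subseteq> \<Omega>" using R by auto
  show meas: "refines_on \<Omega> F (\<lambda>w. w \<in> R)"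
    unfolding refines_on_def
  proof (intro ballI impI)
    fix v w assume vw: "v \<in> \<Omega>" "w \<in> \<Omega>" "F v = F w"
    then have "F0 v = F0 w" using ref unfolding refines_on_def by blast
    then show "(v \<in> R) = (w \<in> R)"
      using vw dens_cong[of F v w \<Omega> E] dens_cong[of F0 v w \<Omega> E] by (simp add: R)
  qed
  have finE: "finite E" using fin sub finite_subset by auto
  have "(\<Sum>w\<in>R. dens F \<Omega> E w) = (\<Sum>v\<in>E. dens F \<Omega> R v)"
    using sum_dens_swap[OF fin sub sR, of F "\<lambda>_. 1"] by (simp add: refines_on_def)
  also have "\<dots> = (\<Sum>v\<in>E. if v \<in> R then 1 else 0)"
    using dens_eq_indicator[OF fin sR meas] sub by (intro sum.cong) auto
  also have "\<dots> = real (card (E \<inter> R))" using finE by (simp add: sum.If_cases)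
  finally have "real (card (E \<inter> R)) = (\<Sum>w\<in>R. dens F \<Omega> E w)" by simp
  also have "\<dots> \<le> (\<Sum>w\<in>R. dens F0 \<Omega> E w / 2)"
    using R by (intro sum_mono) auto
  finally show "real (card (E \<inter> R)) \<le> (\<Sum>w\<in>R. dens F0 \<Omega> E w) / 2"
    by (simp add: sum_divide_distrib)
qed

section \<open>Product colourings, slices and rectangles\<close>

lemma refines_on_map_prod:
  assumes "refines_on X f' f" "refines_on Y g' g"
  shows "refines_on (X \<times> Y) (map_prod f' g') (map_prod f g)"
  unfolding refines_on_def
proof (intro ballI impI)
  fix v w assume vw: "v \<in> X \<times> Y" "w \<in> X \<times> Y" "map_prod f' g' v = map_prod f' g' w"
  obtain x y x' y' where v: "v = (x, y)" and w: "w = (x', y')" by (cases v, cases w) auto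
  have "x \<in> X" "x' \<in> X" "f' x = f' x'" "y \<in> Y" "y' \<in> Y" "g' y = g' y'"
    using vw v w by auto
  then have "f x = f x'" "g y = g y'" using assms unfolding refines_on_def by blast+
  then show "map_prod f g v = map_prod f g w" by (simp add: v w)
qed

lemma dens_Times:
  fixes X :: "'a set" and Y :: "'b set"
  assumes "U \<subseteq> X" "V \<subseteq> Y"
  shows "dens (map_prod f g) (X \<times> Y) (U \<times> V) (x, y) = dens f X U x * dens g Y V y"
proof -
  have "{v \<in> U \<times> V. map_prod f g v = map_prod f g (x, y)}
      = {u\<in>U. f u = f x} \<times> {v\<in>V. g v = g y}" for U :: "'a set" and V :: "'b set"
    by auto
  then show ?thesis by (simp add: dens_def card_cartesian_product)
qed

text \<open>As \<open>id\<close> gives each \<open>b\<close> its own colour, the cell of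
  \<open>(x, b)\<close> stays in the slice at \<open>b\<close>.\<close>

lemma dens_slice:
  fixes X :: "'a set" and B :: "'b set"
  assumes "E \<subseteq> X \<times> B" "b \<in> B"
  shows "dens (map_prod f id) (X \<times> B) E (x, b) = dens f X {x. (x, b) \<in> E} x"
proof -
  have "{v\<in>E. map_prod f id v = map_prod f id (x, b)}
      = (\<lambda>x. (x, b)) ` {u \<in> {x. (x, b) \<in> E}. f u = f x}" for E :: "('a \<times> 'b) set"
    by auto
  then have "card {v\<in>E. map_prod f id v = map_prod f id (x, b)}
      = card {u \<in> {x. (x, b) \<in> E}. f u = f x}" for E :: "('a \<times> 'b) set"
    by (simp add: card_image inj_on_def)
  then show ?thesis using assms(2) by (simp add: dens_def)
qed

text \<open>From the cell of \<open>(x0, y0)\<close> discard \<open>R\<close> and the strips where a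
  refined density is at most half the old one. At least 5/8 of the cell remains, and there
  \<open>U \<times> V\<close> keeps at least a quarter of its old density; 5/8 * 1/4 = 5/32.\<close>

lemma uncovered_rectangle:
  fixes f :: "'a \<Rightarrow> 'c" and f' :: "'a \<Rightarrow> 'd" and g :: "'b \<Rightarrow> 'e" and g' :: "'b \<Rightarrow> 'f"
  assumes fin: "finite X" "finite Y" and x0: "x0 \<in> X" and y0: "y0 \<in> Y"
    and U: "U \<subseteq> X" and V: "V \<subseteq> Y" and R: "R \<subseteq> X \<times> Y"
    and f: "refines_on X f' f" and g: "refines_on Y g' g"
    and meas: "refines_on (X \<times> Y) (map_prod f' g') (\<lambda>w. w \<in> R)"
    and small: "dens f X {x\<in>X. dens f' X U x \<le> dens f X U x / 2} x0
      + dens g Y {y\<in>Y. dens g' Y V y \<le> dens g Y V y / 2} y0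
      + dens (map_prod f g) (X \<times> Y) R (x0, y0) \<le> 3/8"
  shows "5/32 * (dens f X U x0 * dens g Y V y0)
    \<le> dens (map_prod f g) (X \<times> Y) (U \<times> V - R) (x0, y0)"
proof -
  define P where "P = {x\<in>X. f x = f x0}"
  define Q where "Q = {y\<in>Y. g y = g y0}"
  let ?p = "dens f X U x0" and ?q = "dens g Y V y0"
  define LP where "LP = {x\<in>P. dens f' X U x \<le> ?p / 2}"
  define LQ where "LQ = {y\<in>Q. dens g' Y V y \<le> ?q / 2}"
  define W where "W = (P - LP) \<times> (Q - LQ) - R"
  let ?F = "map_prod f g" and ?F' = "map_prod f' g'"
  have finPQ: "finite P" "finite Q" using fin by (auto simp: P_def Q_def)
  have sub: "LP \<subseteq> P" "LQ \<subseteq> Q" "P \<subseteq> X" "Q \<subseteq> Y" by (auto simp: LP_def LQ_def P_def Q_def)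
  have pos: "real (card P) > 0" "real (card Q) > 0"
    using finPQ x0 y0 by (auto simp: card_gt_0_iff P_def Q_def)
  have cell: "{v\<in>X \<times> Y. ?F v = ?F (x0, y0)} = P \<times> Q"
    by (auto simp: P_def Q_def)
  have "LP = {u\<in>P. dens f' X U u \<le> dens f X U u / 2}"
  proof -
    have "dens f X U u = dens f X U x0" if "u \<in> P" for u
      using that by (intro dens_cong) (simp add: P_def)
    then show ?thesis unfolding LP_def by metis
  qed
  then have "{u \<in> {x\<in>X. dens f' X U x \<le> dens f X U x / 2}. f u = f x0} = LP"
    by (auto simp: P_def)
  then have e1: "dens f X {x\<in>X. dens f' X U x \<le> dens f X U x / 2} x0 = card LP / card P"
    by (simp add: dens_def P_def)
  have "LQ = {u\<in>Q. dens g' Y V u \<le> dens g Y V u / 2}"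
  proof -
    have "dens g Y V u = dens g Y V y0" if "u \<in> Q" for u
      using that by (intro dens_cong) (simp add: Q_def)
    then show ?thesis unfolding LQ_def by metis
  qed
  then have "{u \<in> {y\<in>Y. dens g' Y V y \<le> dens g Y V y / 2}. g u = g y0} = LQ"
    by (auto simp: Q_def)
  then have e2: "dens g Y {y\<in>Y. dens g' Y V y \<le> dens g Y V y / 2} y0 = card LQ / card Q"
    by (simp add: dens_def Q_def)
  have "{v\<in>R. ?F v = ?F (x0, y0)} = R \<inter> P \<times> Q" using R by (auto simp: P_def Q_def)
  then have e3: "dens ?F (X \<times> Y) R (x0, y0) = card (R \<inter> P \<times> Q) / (card P * card Q)"
    using cell by (simp add: dens_def card_cartesian_product)
  have W_ge: "5/8 * (real (card P) * real (card Q)) \<le> real (card W)"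
  proof -
    have "P \<times> Q \<subseteq> W \<union> (R \<inter> P \<times> Q) \<union> (LP \<times> Q) \<union> (P \<times> LQ)" by (auto simp: W_def)
    then have "card (P \<times> Q) \<le> card (W \<union> (R \<inter> P \<times> Q) \<union> (LP \<times> Q) \<union> (P \<times> LQ))"
      using finPQ sub by (intro card_mono) (auto simp: W_def intro: finite_subset)
    also have "\<dots> \<le> card W + card (R \<inter> P \<times> Q) + card (LP \<times> Q) + card (P \<times> LQ)"
      by (meson add_mono card_Un_le le_refl order_trans)
    finally have "real (card P * card Q)
        \<le> real (card W + card (R \<inter> P \<times> Q) + card LP * card Q + card P * card LQ)"
      by (simp only: card_cartesian_product of_nat_le_iff)
    moreover have "(card LP / card P + card LQ / card Q + card (R \<inter> P \<times> Q) / (card P * card Q))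
        * (real (card P) * card Q) \<le> 3/8 * (real (card P) * card Q)"
      using small e1 e2 e3 pos by (intro mult_right_mono) auto
    moreover have "(card LP / card P + card LQ / card Q + card (R \<inter> P \<times> Q) / (card P * card Q))
        * (real (card P) * card Q) = real (card LP) * card Q + card P * real (card LQ) + card (R \<inter> P \<times> Q)"
      using pos by (simp add: field_simps)
    ultimately show ?thesis by simp
  qed
  have finW: "finite W" using finPQ by (simp add: W_def)
  have WXY: "W \<subseteq> X \<times> Y" using sub by (auto simp: W_def)
  have measW: "refines_on (X \<times> Y) ?F' (\<lambda>w. w \<in> W)"
    unfolding refines_on_def
  proof (intro ballI impI)
    fix v w assume vw: "v \<in> X \<times> Y" "w \<in> X \<times> Y" "?F' v = ?F' w"
    obtain x y x' y' where v: "v = (x, y)" and w: "w = (x', y')" by (cases v, cases w) auto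
    have xy: "x \<in> X" "x' \<in> X" "f' x = f' x'" "y \<in> Y" "y' \<in> Y" "g' y = g' y'"
      using vw v w by auto
    then have "f x = f x'" "g y = g y'" using f g unfolding refines_on_def by blast+
    moreover have "v \<in> R \<longleftrightarrow> w \<in> R" using meas vw unfolding refines_on_def by blast
    ultimately show "(v \<in> W) = (w \<in> W)"
      using xy dens_cong[of f' x x' X U] dens_cong[of g' y y' Y V]
      by (simp add: v w W_def LP_def LQ_def P_def Q_def)
  qed
  have UV: "U \<times> V \<subseteq> X \<times> Y" using U V by auto
  have "finite (X \<times> Y)" using fin by simp
  note swap = sum_dens_swap[OF this UV WXY, of ?F' "\<lambda>_. 1"]
    and ind = dens_eq_indicator[OF this WXY measW]
  have "?p / 2 * (?q / 2) * real (card W) = (\<Sum>w\<in>W. ?p / 2 * (?q / 2))" by simp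
  also have "\<dots> \<le> (\<Sum>w\<in>W. dens ?F' (X \<times> Y) (U \<times> V) w)"
  proof (rule sum_mono)
    fix w assume w: "w \<in> W"
    obtain x y where "w = (x, y)" by (cases w)
    with w have "?p / 2 \<le> dens f' X U x" "?q / 2 \<le> dens g' Y V y"
      by (auto simp: W_def LP_def LQ_def)
    then show "?p / 2 * (?q / 2) \<le> dens ?F' (X \<times> Y) (U \<times> V) w"
      unfolding \<open>w = (x, y)\<close> dens_Times[OF U V]
      by (intro mult_mono) (auto simp: dens_nonneg)
  qed
  also have "\<dots> = (\<Sum>v\<in>U \<times> V. dens ?F' (X \<times> Y) W v)"
    using swap by (simp add: refines_on_def)
  also have "\<dots> = (\<Sum>v\<in>U \<times> V. if v \<in> W then 1 else 0)"
    using ind UV by (intro sum.cong) auto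
  also have "\<dots> = real (card (U \<times> V \<inter> W))"
    using finite_subset[OF UV] fin by (simp add: sum.If_cases)
  also have "\<dots> \<le> real (card {v\<in>U \<times> V - R. ?F v = ?F (x0, y0)})"
  proof -
    have "U \<times> V \<inter> W \<subseteq> {v\<in>U \<times> V - R. ?F v = ?F (x0, y0)}"
      by (auto simp: W_def P_def Q_def)
    then show ?thesis
      using finite_subset[OF UV] fin by (simp add: card_mono)
  qed
  finally have "?p / 2 * (?q / 2) * real (card W)
      \<le> real (card {v\<in>U \<times> V - R. ?F v = ?F (x0, y0)})" .
  moreover have "?p / 2 * (?q / 2) * (5/8 * (real (card P) * real (card Q)))
      \<le> ?p / 2 * (?q / 2) * real (card W)"
    using W_ge by (intro mult_left_mono) (auto simp: dens_nonneg)
  ultimately have "5/32 * (?p * ?q) * (real (card P) * real (card Q))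
      \<le> real (card {v\<in>U \<times> V - R. ?F v = ?F (x0, y0)})"
    by (simp add: algebra_simps)
  moreover have "dens ?F (X \<times> Y) (U \<times> V - R) (x0, y0)
      = real (card {v\<in>U \<times> V - R. ?F v = ?F (x0, y0)}) / (real (card P) * real (card Q))"
    unfolding dens_def cell by (simp add: card_cartesian_product)
  ultimately show ?thesis
    using pos by (simp add: pos_le_divide_eq)
qed

section \<open>Edge-disjoint triangles\<close>

text \<open>The triple \<^term>\<open>(x, y, b)\<close> stands for a triangle in a tripartite graph, and \<^term>\<open>M\<close> is the set of
  all triangles of the graph formed by their edges.\<close>

locale edge_disjoint_triangles =
  fixes X :: "'a set" and Y :: "'b set" and B :: "'c set" and M :: "('a \<times> 'b \<times> 'c) set"
  assumes finite_X: "finite X" and finite_Y: "finite Y" and finite_B: "finite B"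
    and M_subset: "M \<subseteq> X \<times> Y \<times> B"
    and unique_x: "\<lbrakk>(x, y, b) \<in> M; (x', y, b) \<in> M\<rbrakk> \<Longrightarrow> x = x'"
    and unique_y: "\<lbrakk>(x, y, b) \<in> M; (x, y', b) \<in> M\<rbrakk> \<Longrightarrow> y = y'"
    and unique_b: "\<lbrakk>(x, y, b) \<in> M; (x, y, b') \<in> M\<rbrakk> \<Longrightarrow> b = b'"
    and triangle: "\<lbrakk>(x, y, b') \<in> M; (x, y', b) \<in> M; (x', y, b) \<in> M\<rbrakk> \<Longrightarrow> (x, y, b) \<in> M"
begin

definition XY :: "('a \<times> 'b) set" where "XY = (\<lambda>(x, y, b). (x, y)) ` M"
definition XB :: "('a \<times> 'c) set" where "XB = (\<lambda>(x, y, b). (x, b)) ` M"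
definition YB :: "('b \<times> 'c) set" where "YB = (\<lambda>(x, y, b). (y, b)) ` M"

abbreviation nbX :: "'c \<Rightarrow> 'a set" where "nbX b \<equiv> {x. (x, b) \<in> XB}"
abbreviation nbY :: "'c \<Rightarrow> 'b set" where "nbY b \<equiv> {y. (y, b) \<in> YB}"

definition colX :: "'c set \<Rightarrow> 'a \<Rightarrow> 'c set" where "colX S x = {b\<in>S. (x, b) \<in> XB}"
definition colY :: "'c set \<Rightarrow> 'b \<Rightarrow> 'c set" where "colY S y = {b\<in>S. (y, b) \<in> YB}"

definition entropy :: "'c set \<Rightarrow> real" where
  "entropy S = ent (map_prod (colX S) (colY S)) (X \<times> Y) XY
     + ent (map_prod (colX S) id) (X \<times> B) XB + ent (map_prod (colY S) id) (Y \<times> B) YB"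

lemma finite_M: "finite M"
  by (rule finite_subset[OF M_subset]) (intro finite_cartesian_product finite_X finite_Y finite_B)

lemma finite_XY: "finite (X \<times> Y)" and finite_XB: "finite (X \<times> B)" and finite_YB: "finite (Y \<times> B)"
  using finite_X finite_Y finite_B by auto

lemma XY_subset: "XY \<subseteq> X \<times> Y" and XB_subset: "XB \<subseteq> X \<times> B" and YB_subset: "YB \<subseteq> Y \<times> B"
  using M_subset by (auto simp: XY_def XB_def YB_def)

lemma inj_XY: "inj_on (\<lambda>(x, y, b). (x, y)) M"
  and inj_XB: "inj_on (\<lambda>(x, y, b). (x, b)) M"
  and inj_YB: "inj_on (\<lambda>(x, y, b). (y, b)) M"
  by (auto simp: inj_on_def dest: unique_x unique_y unique_b)

lemma card_edges: "card XY = card M" "card XB = card M" "card YB = card M"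
  unfolding XY_def XB_def YB_def
  by (rule card_image[OF inj_XY] card_image[OF inj_XB] card_image[OF inj_YB])+

text \<open>Each edge lies in exactly one triangle, so sums over the three edge sets share the index
  set \<open>M\<close> and can be added pointwise.\<close>

lemma sum_edges:
  "(\<Sum>e\<in>XY. f e) = (\<Sum>(x, y, b)\<in>M. f (x, y))"
  "(\<Sum>e\<in>XB. g e) = (\<Sum>(x, y, b)\<in>M. g (x, b))"
  "(\<Sum>e\<in>YB. h e) = (\<Sum>(x, y, b)\<in>M. h (y, b))"
  unfolding XY_def XB_def YB_def sum.reindex[OF inj_XY] sum.reindex[OF inj_XB] sum.reindex[OF inj_YB]
  by (simp_all add: case_prod_unfold o_def)

lemma refines_colX: "S \<subseteq> S' \<Longrightarrow> refines_on X (colX S') (colX S)"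
  and refines_colY: "S \<subseteq> S' \<Longrightarrow> refines_on Y (colY S') (colY S)"
proof -
  assume "S \<subseteq> S'"
  then have "colX S x = S \<inter> colX S' x" "colY S y = S \<inter> colY S' y" for x y
    by (auto simp: colX_def colY_def)
  then show "refines_on X (colX S') (colX S)" "refines_on Y (colY S') (colY S)"
    unfolding refines_on_def by simp_all
qed

lemma entropy_nonpos: "entropy S \<le> 0"
  unfolding entropy_def
  by (intro add_nonpos_nonpos ent_nonpos finite_XY finite_XB finite_YB XY_subset XB_subset YB_subset)

lemma entropy_ge:
  assumes "0 < \<delta>" "\<delta> * real (card (X \<times> Y)) \<le> real (card M)"
    "\<delta> * real (card (X \<times> B)) \<le> real (card M)" "\<delta> * real (card (Y \<times> B)) \<le> real (card M)"
  shows "3 * real (card M) * ln \<delta> \<le> entropy S"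
proof -
  note ge = ent_ge_ln[OF _ _ assms(1)]
  have "real (card M) * ln \<delta> \<le> ent (map_prod (colX S) (colY S)) (X \<times> Y) XY"
    using ge[OF finite_XY XY_subset] assms card_edges by simp
  moreover have "real (card M) * ln \<delta> \<le> ent (map_prod (colX S) id) (X \<times> B) XB"
    using ge[OF finite_XB XB_subset] assms card_edges by simp
  moreover have "real (card M) * ln \<delta> \<le> ent (map_prod (colY S) id) (Y \<times> B) YB"
    using ge[OF finite_YB YB_subset] assms card_edges by simp
  ultimately show ?thesis unfolding entropy_def by linarith
qed

text \<open>An edge \<open>(x, y)\<close> covered by \<open>b\<close> forms a triangle with
  \<open>(x, b)\<close> and \<open>(y, b)\<close>, which lies in \<open>M\<close> and is determined
  by \<open>b\<close> and \<open>x\<close>.\<close>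

lemma card_covered_edges_le:
  assumes "S \<subseteq> B"
  shows "card (XY \<inter> (\<Union>b\<in>S. nbX b \<times> nbY b)) \<le> card S * card X"
proof -
  let ?T = "{(x, y, b)\<in>M. b \<in> S}"
  have "XY \<inter> (\<Union>b\<in>S. nbX b \<times> nbY b) \<subseteq> (\<lambda>(x, y, b). (x, y)) ` ?T"
  proof
    fix e assume "e \<in> XY \<inter> (\<Union>b\<in>S. nbX b \<times> nbY b)"
    then obtain x y b where e: "e = (x, y)" "(x, y) \<in> XY" "b \<in> S" "(x, b) \<in> XB" "(y, b) \<in> YB"
      by auto
    then obtain b' y' x' where "(x, y, b') \<in> M" "(x, y', b) \<in> M" "(x', y, b) \<in> M"
      unfolding XY_def XB_def YB_def by auto
    then have "(x, y, b) \<in> M" by (rule triangle)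
    with e show "e \<in> (\<lambda>(x, y, b). (x, y)) ` ?T" by force
  qed
  then have "card (XY \<inter> (\<Union>b\<in>S. nbX b \<times> nbY b)) \<le> card ?T"
    using surj_card_le[of ?T] finite_subset[OF _ finite_M, of ?T] by auto
  also have "card ?T \<le> card (S \<times> X)"
  proof (rule card_inj_on_le)
    show "inj_on (\<lambda>(x, y, b). (b, x)) ?T"
      by (auto simp: inj_on_def dest: unique_y)
    show "(\<lambda>(x, y, b). (b, x)) ` ?T \<subseteq> S \<times> X" using M_subset by auto
    show "finite (S \<times> X)" using assms finite_B finite_X finite_subset by auto
  qed
  finally show ?thesis by (simp add: card_cartesian_product)
qed

text \<open>\<open>S'\<close> is chosen before its size is compared with \<open>M\<close>, so the
  gain is conditional on that comparison. The factor \<open>4 ^ card S\<close> bounds the number of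
  pairs of old colours.\<close>

lemma entropy_increment:
  assumes d: "0 < \<delta>" and dXB: "\<delta> * real (card (X \<times> B)) \<le> real (card M)"
    and dYB: "\<delta> * real (card (Y \<times> B)) \<le> real (card M)"
    and S: "S \<subseteq> B" and m: "card M > 0"
  obtains S' where "S \<subseteq> S'" "S' \<subseteq> B"
    "real (card S') \<le> real (card S) + 128 / \<delta>\<^sup>2 * 4 ^ card S"
    "32 * real (card S' * card X) \<le> real (card M) \<Longrightarrow>
      entropy S + real (card M) / 192 \<le> entropy S'"
proof -
  define m where "m = real (card M)"
  \<comment> \<open>The final contradiction needs \<open>\<eta>\<close> below 5/32 * (\<delta>/4)^2
    = 5 \<delta>^2 / 512; this choice is 4 \<delta>^2 / 512.\<close>
  define \<eta> where "\<eta> = \<delta>\<^sup>2 / 128"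
  have eta: "0 < \<eta>" using d by (simp add: \<eta>_def)
  define Q where "Q b = nbX b \<times> nbY b" for b
  let ?F = "\<lambda>S. map_prod (colX S) (colY S)"
  let ?G = "\<lambda>S. map_prod (colX S) (id :: 'c \<Rightarrow> 'c)"
  let ?H = "\<lambda>S. map_prod (colY S) (id :: 'c \<Rightarrow> 'c)"
  \<comment> \<open>Every old cell has total weight 1, so the weight of a subset of one cell is its
    density there.\<close>
  define w where "w v = 1 / real (card {u\<in>X \<times> Y. ?F S u = ?F S v})" for v
  have Q: "Q b \<subseteq> X \<times> Y" for b using XB_subset YB_subset by (auto simp: Q_def)
  have finS: "finite S" using S finite_B finite_subset by auto
  obtain S' where S': "S \<subseteq> S'" "S' \<subseteq> B"
      and card': "\<eta> * (real (card S') - real (card S)) \<le> (\<Sum>v\<in>X \<times> Y. w v)"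
      and sat: "\<And>b. b \<in> B \<Longrightarrow> (\<Sum>v\<in>Q b - (\<Union>s\<in>S'. Q s). w v) \<le> \<eta>"
    using exists_saturated_superset[of "X \<times> Y" B Q w S \<eta>] finite_XY finite_B Q S eta
    by (auto simp: w_def)
  define R where "R = (\<Union>s\<in>S'. Q s)"
  define RX where "RX = {e\<in>X \<times> B. dens (?G S') (X \<times> B) XB e \<le> dens (?G S) (X \<times> B) XB e / 2}"
  define RY where "RY = {e\<in>Y \<times> B. dens (?H S') (Y \<times> B) YB e \<le> dens (?H S) (Y \<times> B) YB e / 2}"
  have R: "R \<subseteq> X \<times> Y" using Q by (auto simp: R_def)
  have sRX: "RX \<subseteq> X \<times> B" and sRY: "RY \<subseteq> Y \<times> B" by (auto simp: RX_def RY_def)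
  have measR: "refines_on (X \<times> Y) (?F S') (\<lambda>w. w \<in> R)"
    unfolding refines_on_def
  proof (intro ballI impI)
    fix v w assume vw: "v \<in> X \<times> Y" "w \<in> X \<times> Y" "?F S' v = ?F S' w"
    \<comment> \<open>A pair is covered by \<open>S'\<close> exactly when its two new colours, both
      subsets of \<open>S'\<close>, share an element; hence the new colouring decides membership in
      \<open>R\<close>.\<close>
    have *: "u \<in> R \<longleftrightarrow> fst (?F S' u) \<inter> snd (?F S' u) \<noteq> {}" for u
      by (cases u) (auto simp: R_def Q_def colX_def colY_def)
    show "(v \<in> R) = (w \<in> R)" unfolding * vw(3) ..
  qed
  note refX = refines_colX[OF S'(1)] and refY = refines_colY[OF S'(1)]
  have refB: "refines_on B id id" by (simp add: refines_on_def)
  note refF = refines_on_map_prod[OF refX refY]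
    and refG = refines_on_map_prod[OF refX refB] and refH = refines_on_map_prod[OF refY refB]
  have sumXY: "(\<Sum>e\<in>R. dens (?F S) (X \<times> Y) XY e) = (\<Sum>(x, y, b)\<in>M. dens (?F S) (X \<times> Y) R (x, y))"
    using sum_dens_swap[OF finite_XY XY_subset R, of "?F S" "\<lambda>_. 1"]
    by (simp add: refines_on_def sum_edges)
  have sumXB: "(\<Sum>e\<in>RX. dens (?G S) (X \<times> B) XB e) = (\<Sum>(x, y, b)\<in>M. dens (?G S) (X \<times> B) RX (x, b))"
    using sum_dens_swap[OF finite_XB XB_subset sRX, of "?G S" "\<lambda>_. 1"]
    by (simp add: refines_on_def sum_edges)
  have sumYB: "(\<Sum>e\<in>RY. dens (?H S) (Y \<times> B) YB e) = (\<Sum>(x, y, b)\<in>M. dens (?H S) (Y \<times> B) RY (y, b))"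
    using sum_dens_swap[OF finite_YB YB_subset sRY, of "?H S" "\<lambda>_. 1"]
    by (simp add: refines_on_def sum_edges)
  show ?thesis
  proof (rule that[OF S'])
    have "(\<Sum>v\<in>X \<times> Y. w v) \<le> real (card (Pow S \<times> Pow S))"
      unfolding w_def
      by (rule sum_inverse_cell_card_le) (use finite_XY finS in \<open>auto simp: colX_def colY_def\<close>)
    also have "\<dots> = 4 ^ card S"
      using finS by (simp add: card_cartesian_product card_Pow flip: power_mult_distrib)
    finally have "\<eta> * (real (card S') - real (card S)) \<le> 4 ^ card S" using card' by simp
    then show "real (card S') \<le> real (card S) + 128 / \<delta>\<^sup>2 * 4 ^ card S"
      using d by (simp add: \<eta>_def field_simps)
  next
    assume size: "32 * real (card S' * card X) \<le> real (card M)"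
    have covered: "32 * real (card (XY \<inter> R)) \<le> m"
    proof -
      have "real (card (XY \<inter> R)) \<le> real (card S' * card X)"
        using card_covered_edges_le[OF S'(2)] unfolding R_def Q_def of_nat_le_iff .
      then show ?thesis using size by (simp add: m_def)
    qed
    have monoF: "ent (?F S) (X \<times> Y) XY \<le> ent (?F S') (X \<times> Y) XY"
      by (rule ent_mono[OF finite_XY XY_subset refF])
    have monoG: "ent (?G S) (X \<times> B) XB \<le> ent (?G S') (X \<times> B) XB"
      by (rule ent_mono[OF finite_XB XB_subset refG])
    have monoH: "ent (?H S) (Y \<times> B) YB \<le> ent (?H S') (Y \<times> B) YB"
      by (rule ent_mono[OF finite_YB YB_subset refH])
    have gainG: "ent (?G S) (X \<times> B) XB + 1/12 * (\<Sum>e\<in>RX. dens (?G S) (X \<times> B) XB e)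
        \<le> ent (?G S') (X \<times> B) XB"
      by (rule ent_gain_low[OF finite_XB XB_subset refG RX_def])
    have gainH: "ent (?H S) (Y \<times> B) YB + 1/12 * (\<Sum>e\<in>RY. dens (?H S) (Y \<times> B) YB e)
        \<le> ent (?H S') (Y \<times> B) YB"
      by (rule ent_gain_low[OF finite_YB YB_subset refH RY_def])
    show "entropy S + real (card M) / 192 \<le> entropy S'"
    proof (rule ccontr)
      assume neg: "\<not> entropy S + real (card M) / 192 \<le> entropy S'"
      \<comment> \<open>A gain is 1/12 of such a sum, and 1/12 * m/16 = m/192; the other two terms
        of the entropy do not decrease.\<close>
      have lG: "(\<Sum>e\<in>RX. dens (?G S) (X \<times> B) XB e) < m / 16"
        using neg gainG monoF monoH unfolding entropy_def m_def by linarith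
      have lH: "(\<Sum>e\<in>RY. dens (?H S) (Y \<times> B) YB e) < m / 16"
        using neg gainH monoF monoG unfolding entropy_def m_def by linarith
      have lF: "(\<Sum>e\<in>R. dens (?F S) (X \<times> Y) XY e) < m / 16"
      proof (rule ccontr)
        assume big: "\<not> (\<Sum>e\<in>R. dens (?F S) (X \<times> Y) XY e) < m / 16"
        \<comment> \<open>Half of a sum of at least m/16 exceeds or equals m/32, which is where the
          factor 32 in the size condition comes from.\<close>
        then have "real (card (XY \<inter> R)) \<le> (\<Sum>e\<in>R. dens (?F S) (X \<times> Y) XY e) / 2"
          using covered by simp
        from ent_refine_gain[OF finite_XY XY_subset R refF measR this]
        show False using neg big monoG monoH unfolding entropy_def m_def by linarith
      qed
      define \<rho> where "\<rho> = (\<lambda>(x, y, b). dens (?F S) (X \<times> Y) R (x, y)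
        + dens (?G S) (X \<times> B) RX (x, b) + dens (?H S) (Y \<times> B) RY (y, b))"
      have "(\<Sum>\<tau>\<in>M. \<rho> \<tau>) < 3/16 * m"
        using lF lG lH unfolding sumXY sumXB sumYB \<rho>_def
        by (simp add: case_prod_unfold sum.distrib)
      have rho_nn: "0 \<le> \<rho> \<tau>" for \<tau>
        by (simp add: \<rho>_def case_prod_unfold dens_nonneg)
      \<comment> \<open>At most m/4 triangles have \<open>(x, b)\<close> in a cell this sparse, and
        likewise for \<open>(y, b)\<close>. At least m/2 survive, so the mean of
        \<open>\<rho>\<close> over them is below 3/8.\<close>
      define MX where
        "MX = {\<tau>\<in>M. dens (?G S) (X \<times> B) XB ((\<lambda>(x, y, b). (x, b)) \<tau>) < \<delta> / 4}"
      define MY where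
        "MY = {\<tau>\<in>M. dens (?H S) (Y \<times> B) YB ((\<lambda>(x, y, b). (y, b)) \<tau>) < \<delta> / 4}"
      have "real (card MX) \<le> m / 4"
      proof -
        have "(\<lambda>(x, y, b). (x, b)) ` MX = {e\<in>XB. dens (?G S) (X \<times> B) XB e < \<delta> / 4}"
          unfolding MX_def XB_def by blast
        moreover have "inj_on (\<lambda>(x, y, b). (x, b)) MX"
          by (rule inj_on_subset[OF inj_XB]) (auto simp: MX_def)
        ultimately have "card MX = card {e\<in>XB. dens (?G S) (X \<times> B) XB e < \<delta> / 4}"
          by (metis card_image)
        also have "real \<dots> \<le> \<delta> / 4 * real (card (X \<times> B))"
          by (rule card_low_dens_le[OF finite_XB XB_subset]) (use d in simp)
        finally show ?thesis using dXB by (simp add: m_def)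
      qed
      moreover have "real (card MY) \<le> m / 4"
      proof -
        have "(\<lambda>(x, y, b). (y, b)) ` MY = {e\<in>YB. dens (?H S) (Y \<times> B) YB e < \<delta> / 4}"
          unfolding MY_def YB_def by blast
        moreover have "inj_on (\<lambda>(x, y, b). (y, b)) MY"
          by (rule inj_on_subset[OF inj_YB]) (auto simp: MY_def)
        ultimately have "card MY = card {e\<in>YB. dens (?H S) (Y \<times> B) YB e < \<delta> / 4}"
          by (metis card_image)
        also have "real \<dots> \<le> \<delta> / 4 * real (card (Y \<times> B))"
          by (rule card_low_dens_le[OF finite_YB YB_subset]) (use d in simp)
        finally show ?thesis using dYB by (simp add: m_def)
      qed
      moreover have "card M \<le> card (M - MX - MY) + card MX + card MY"
      proof -
        have "MX \<subseteq> M" "MY \<subseteq> M" by (auto simp: MX_def MY_def)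
        then have "M = (M - MX - MY) \<union> MX \<union> MY" by auto
        then have "card M = card ((M - MX - MY) \<union> MX \<union> MY)" by simp
        also have "\<dots> \<le> card (M - MX - MY) + card MX + card MY"
          by (meson add_mono card_Un_le le_refl order_trans)
        finally show ?thesis .
      qed
      ultimately have good: "m / 2 \<le> real (card (M - MX - MY))" unfolding m_def by linarith
      have "\<exists>\<tau>\<in>M - MX - MY. \<rho> \<tau> < 3/8"
      proof (rule ccontr)
        assume "\<not> (\<exists>\<tau>\<in>M - MX - MY. \<rho> \<tau> < 3/8)"
        then have "3/8 \<le> \<rho> \<tau>" if "\<tau> \<in> M - MX - MY" for \<tau>
          using that by (meson not_less)
        then have "real (card (M - MX - MY)) * (3/8) \<le> (\<Sum>\<tau>\<in>M - MX - MY. \<rho> \<tau>)"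
          by (rule sum_bounded_below)
        also have "\<dots> \<le> (\<Sum>\<tau>\<in>M. \<rho> \<tau>)"
          by (rule sum_mono2[OF finite_M]) (auto simp: rho_nn)
        finally show False using good \<open>(\<Sum>\<tau>\<in>M. \<rho> \<tau>) < 3/16 * m\<close> by linarith
      qed
      then obtain x y b where xyb: "(x, y, b) \<in> M" "(x, y, b) \<notin> MX" "(x, y, b) \<notin> MY"
        and small: "\<rho> (x, y, b) < 3/8" by auto
      have mem: "x \<in> X" "y \<in> Y" "b \<in> B" using xyb M_subset by auto
      let ?U = "nbX b" and ?V = "nbY b"
      let ?p = "dens (colX S) X ?U x" and ?q = "dens (colY S) Y ?V y"
      note sG = dens_slice[OF XB_subset mem(3)] and sH = dens_slice[OF YB_subset mem(3)]
      have p: "\<delta> / 4 \<le> ?p" and q: "\<delta> / 4 \<le> ?q"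
        using xyb by (auto simp: MX_def MY_def sG sH)
      have UX: "?U \<subseteq> X" and VY: "?V \<subseteq> Y" using XB_subset YB_subset by auto
      have "{x. (x, b) \<in> RX} = {x\<in>X. dens (colX S') X ?U x \<le> dens (colX S) X ?U x / 2}"
        "{y. (y, b) \<in> RY} = {y\<in>Y. dens (colY S') Y ?V y \<le> dens (colY S) Y ?V y / 2}"
        using mem by (auto simp: RX_def RY_def sG sH)
      then have "dens (colX S) X {x\<in>X. dens (colX S') X ?U x \<le> dens (colX S) X ?U x / 2} x
          + dens (colY S) Y {y\<in>Y. dens (colY S') Y ?V y \<le> dens (colY S) Y ?V y / 2} y
          + dens (?F S) (X \<times> Y) R (x, y) \<le> 3/8"
        using small by (simp add: \<rho>_def dens_slice[OF sRX mem(3)] dens_slice[OF sRY mem(3)])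
      from uncovered_rectangle[OF finite_X finite_Y mem(1,2) UX VY R refX refY measR this]
      have "5/32 * (?p * ?q) \<le> dens (?F S) (X \<times> Y) (?U \<times> ?V - R) (x, y)" .
      also have "\<dots> = (\<Sum>v\<in>{v\<in>Q b - R. ?F S v = ?F S (x, y)}. w v)"
        by (simp add: dens_def w_def Q_def)
      also have "\<dots> \<le> (\<Sum>v\<in>Q b - R. w v)"
        by (rule sum_mono2) (use finite_subset[OF Q finite_XY] in \<open>auto simp: w_def\<close>)
      also have "\<dots> \<le> \<eta>" using sat[OF mem(3)] by (simp add: R_def)
      finally have "5/32 * (?p * ?q) \<le> \<delta>\<^sup>2 / 128" by (simp add: \<eta>_def)
      moreover have "\<delta> / 4 * (\<delta> / 4) \<le> ?p * ?q"
        using p q d by (intro mult_mono) auto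
      ultimately have "5 * \<delta>\<^sup>2 / 512 \<le> 4 * \<delta>\<^sup>2 / 512" by (simp add: power2_eq_square)
      then show False using d by simp
    qed
  qed
qed

end

section \<open>Iterating the entropy increment\<close>

text \<open>The base value 1 is the threshold at which \<open>log_star\<close> stops, so
  \<open>log_star\<close> inverts \<open>tower\<close> without a shift of index.\<close>

fun tower :: "nat \<Rightarrow> nat" where
  "tower 0 = 1"
| "tower (Suc k) = 2 ^ tower k"

lemma tower_mono: "i \<le> j \<Longrightarrow> tower i \<le> tower j"
  by (rule lift_Suc_mono_le[of tower]) (simp_all add: less_imp_le[OF less_exp])

lemma three_mult_add_one_le_power: "t \<ge> 4 \<Longrightarrow> 3 * t + 1 \<le> (2::nat) ^ t"
  by (induction t rule: nat_induct_at_least) auto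

text \<open>One increment with \<open>card S\<close> and \<open>128 / \<delta>\<^sup>2\<close> at
  most \<open>t\<close> yields a set of size at most \<open>t + t * 4 ^ t\<close>, which two tower
  levels absorb.\<close>

lemma add_mult_power_le_double_exp:
  assumes "t \<ge> (4::nat)"
  shows "t + t * 4 ^ t \<le> 2 ^ 2 ^ t"
proof -
  have "t + t * 4 ^ t = t * (1 + 4 ^ t)" by simp
  also have "\<dots> \<le> 2 ^ t * (2 * 4 ^ t)"
    by (intro mult_mono) (simp_all add: less_imp_le[OF less_exp])
  also have "\<dots> = 2 ^ t * (2 * 2 ^ (2 * t))" by (simp add: power_mult)
  also have "\<dots> = 2 ^ (3 * t + 1)"
    by (simp flip: power_add power_Suc)
  also have "\<dots> \<le> 2 ^ 2 ^ t"
    using three_mult_add_one_le_power[OF assms] by (intro power_increasing) auto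
  finally show ?thesis .
qed

context edge_disjoint_triangles
begin

text \<open>Starting from the empty set, each increment raises the size bound by two tower levels.
  The offset \<open>h\<close> makes the tower dominate \<open>128 / \<delta>\<^sup>2\<close>, and
  smallness at the last level implies it at all earlier ones.\<close>

lemma iterated_increment:
  assumes d: "0 < \<delta>" and dXB: "\<delta> * real (card (X \<times> B)) \<le> real (card M)"
    and dYB: "\<delta> * real (card (Y \<times> B)) \<le> real (card M)" and m: "card M > 0"
    and h: "4 \<le> tower h" "128 / \<delta>\<^sup>2 \<le> real (tower h)"
    and small: "32 * tower (h + 2 * s) * card X \<le> card M"
  shows "\<exists>S\<subseteq>B. card S \<le> tower (h + 2 * s) \<and>
    entropy {} + real s * (real (card M) / 192) \<le> entropy S"
  using small
proof (induction s)
  case 0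
  then show ?case by (intro exI[of _ "{}"]) simp
next
  case (Suc s)
  define t where "t = tower (h + 2 * s)"
  have next_t: "tower (h + 2 * Suc s) = 2 ^ 2 ^ t" by (simp add: t_def)
  have ht: "tower h \<le> t" unfolding t_def by (rule tower_mono) simp
  have "t \<le> tower (h + 2 * Suc s)" unfolding t_def by (rule tower_mono) simp
  then have "32 * t * card X \<le> card M"
    using Suc.prems by (meson le_trans mult_le_mono le_refl)
  then obtain S where S: "S \<subseteq> B" "card S \<le> t"
      "entropy {} + real s * (real (card M) / 192) \<le> entropy S"
    using Suc.IH unfolding t_def by blast
  obtain S' where S': "S \<subseteq> S'" "S' \<subseteq> B"
      "real (card S') \<le> real (card S) + 128 / \<delta>\<^sup>2 * 4 ^ card S"
      "32 * real (card S' * card X) \<le> real (card M) \<Longrightarrow>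
        entropy S + real (card M) / 192 \<le> entropy S'"
    using entropy_increment[OF d dXB dYB S(1) m] by blast
  have "128 / \<delta>\<^sup>2 * 4 ^ card S \<le> real t * 4 ^ t"
    using h(2) ht S(2) by (intro mult_mono power_increasing) auto
  then have "real (card S') \<le> real (t + t * 4 ^ t)"
    using S'(3) S(2) by simp
  then have "card S' \<le> t + t * 4 ^ t" by (simp only: of_nat_le_iff)
  also have "\<dots> \<le> 2 ^ 2 ^ t" using h(1) ht by (intro add_mult_power_le_double_exp) simp
  finally have card': "card S' \<le> tower (h + 2 * Suc s)" unfolding next_t .
  then have "32 * card S' * card X \<le> card M"
    using Suc.prems by (meson le_trans mult_le_mono le_refl)
  then have "real (32 * card S' * card X) \<le> real (card M)" by (simp only: of_nat_le_iff)
  then have "entropy S + real (card M) / 192 \<le> entropy S'" by (intro S'(4)) simp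
  then have "entropy {} + real (Suc s) * (real (card M) / 192) \<le> entropy S'"
    using S(3) by (simp add: distrib_right add_divide_distrib)
  with card' S'(2) show ?case by blast
qed

text \<open>Otherwise \<open>s\<close> gains of \<open>card M / 192\<close> would lift the entropy
  from at least \<open>3 * card M * ln \<delta>\<close> above its upper bound 0; 576 = 3 *
  192.\<close>

lemma card_triangles_less:
  assumes d: "0 < \<delta>" and dXY: "\<delta> * real (card (X \<times> Y)) \<le> real (card M)"
    and dXB: "\<delta> * real (card (X \<times> B)) \<le> real (card M)"
    and dYB: "\<delta> * real (card (Y \<times> B)) \<le> real (card M)" and m: "card M > 0"
    and h: "4 \<le> tower h" "128 / \<delta>\<^sup>2 \<le> real (tower h)"
    and s: "576 * ln (1 / \<delta>) < real s"
  shows "card M < 32 * tower (h + 2 * s) * card X"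
proof (rule ccontr)
  assume "\<not> card M < 32 * tower (h + 2 * s) * card X"
  then obtain S where "entropy {} + real s * (real (card M) / 192) \<le> entropy S"
    using iterated_increment[OF d dXB dYB m h, of s] by auto
  then have "3 * real (card M) * ln \<delta> + real s * (real (card M) / 192) \<le> 0"
    using entropy_ge[OF d dXY dXB dYB, of "{}"] entropy_nonpos[of S] by linarith
  then have "real (card M) / 192 * (576 * ln \<delta> + real s) \<le> 0" by (simp add: algebra_simps)
  then have "576 * ln \<delta> + real s \<le> 0" using m by (simp add: mult_le_0_iff)
  then show False using s d by (simp add: ln_div)
qed

end

section \<open>The iterated logarithm\<close>

text \<open>The induction hypothesis is applied to \<open>log 2 x\<close>; exponentiating climbs one
  tower level.\<close>

lemma tower_less_of_iterates:
  assumes "\<And>j. j \<le> k \<Longrightarrow> 1 < (log 2 ^^ j) x"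
  shows "real (tower k) < x"
  using assms
proof (induction k arbitrary: x)
  case 0
  then show ?case using "0.prems"[of 0] by simp
next
  case (Suc k)
  have x: "1 < x" using Suc.prems[of 0] by simp
  have "1 < (log 2 ^^ j) (log 2 x)" if "j \<le> k" for j
    using Suc.prems[of "Suc j"] that by (simp add: funpow_swap1)
  then have "real (tower k) < log 2 x" by (rule Suc.IH)
  then have "2 powr real (tower k) < x" using x by (simp add: less_log_iff)
  then show ?case by (simp add: powr_realpow)
qed

lemma tower_less_of_log_star:
  assumes "k < log_star x"
  shows "real (tower k) < x"
proof (rule tower_less_of_iterates)
  fix j assume "j \<le> k"
  then have "j < (LEAST k. (log 2 ^^ k) x \<le> 1)" using assms by (simp add: log_star_def)
  then have "\<not> (log 2 ^^ j) x \<le> 1" by (rule not_less_Least)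
  then show "1 < (log 2 ^^ j) x" by simp
qed

text \<open>The exponent leaves room for the factor \<open>128 * 2 ^ L\<close> when
  \<open>k = L div 2\<close>; 5 is the least \<open>k\<close> for which the bound holds.\<close>

lemma tower_ge_power: "5 \<le> k \<Longrightarrow> 2 ^ (2 * k + 9) \<le> tower k"
proof (induction k rule: nat_induct_at_least)
  case base
  have four: "(4::nat) = Suc (Suc (Suc (Suc 0)))" and five: "(5::nat) = Suc 4" by simp_all
  have "tower 4 = 65536" unfolding four by simp
  then have "(2::nat) ^ (2 * 5 + 9) \<le> 2 ^ tower 4" by (intro power_increasing) auto
  then show ?case unfolding five tower.simps .
next
  case (Suc k)
  have "2 * Suc k + 9 \<le> 2 * (2 * k + 9)" by simp
  also have "\<dots> \<le> 2 * 2 ^ (2 * k + 8)"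
    using less_exp[of "2 * k + 8"] by (intro mult_le_mono2) linarith
  also have "\<dots> = 2 ^ (2 * k + 9)" by (simp flip: power_Suc)
  also have "\<dots> \<le> tower k" by (rule Suc.IH)
  finally show ?case unfolding tower.simps by (rule power_increasing) simp
qed

lemma four_le_tower: "5 \<le> k \<Longrightarrow> 4 \<le> tower k"
  using tower_ge_power[of k] power_increasing[of 2 "2 * k + 9" "2::nat"] by simp

text \<open>The tower index on the left is about 3/4 of \<open>L\<close>, hence at most
  \<open>L - 3\<close>; the two levels left up to \<open>L - 1\<close> absorb the factor
  \<open>32 * 2 ^ L\<close>.\<close>

lemma tower_size_bound:
  assumes "24 < L"
  shows "32 * tower (L div 2 + 2 * (L div 8 + 1)) * 2 ^ L \<le> tower (L - 1)"
proof -
  define k where "k = L - 3"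
  define t where "t = tower k"
  have L: "L = k + 3" and k: "5 \<le> k" using assms by (auto simp: k_def)
  have "L div 2 + 2 * (L div 8 + 1) \<le> k"
  proof -
    have "a + 2 * (b + 1) \<le> L - 3" if "2 * a \<le> L" "8 * b \<le> L" for a b
      using that assms by simp
    then show ?thesis unfolding k_def by simp
  qed
  then have "tower (L div 2 + 2 * (L div 8 + 1)) \<le> t" unfolding t_def by (rule tower_mono)
  then have "32 * tower (L div 2 + 2 * (L div 8 + 1)) * 2 ^ L \<le> 32 * t * 2 ^ L" by simp
  also have "\<dots> = t * 2 ^ (k + 8)" by (simp add: L power_add)
  also have "\<dots> \<le> t * t"
  proof (rule mult_le_mono2)
    have "(2::nat) ^ (k + 8) \<le> 2 ^ (2 * k + 9)" by (intro power_increasing) auto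
    also have "\<dots> \<le> t" unfolding t_def by (rule tower_ge_power[OF k])
    finally show "2 ^ (k + 8) \<le> t" .
  qed
  also have "\<dots> \<le> 2 ^ t * 2 ^ t" by (intro mult_mono) (simp_all add: less_imp_le[OF less_exp])
  also have "\<dots> = 2 ^ (2 * t)" by (simp add: power_add[symmetric] mult_2)
  also have "\<dots> \<le> 2 ^ 2 ^ t"
  proof (rule power_increasing)
    show "2 * t \<le> 2 ^ t"
      using three_mult_add_one_le_power[of t] four_le_tower[OF k] unfolding t_def by linarith
  qed simp
  also have "\<dots> = tower (Suc (Suc k))" by (simp add: t_def)
  also have "Suc (Suc k) = L - 1" by (simp add: L)
  finally show ?thesis .
qed

section \<open>Cylinder intersections of a linjection\<close>

text \<open>The three triples in \<open>triangle\<close> each differ from \<open>(x, y, b)\<close>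
  only in the free coordinate of one cylinder. Uniqueness of \<open>x\<close> and \<open>y\<close>
  is injectivity on columns and rows, and \<open>b\<close> is the value of \<open>A\<close>.\<close>

lemma linjection_edge_disjoint_triangles:
  assumes lin: "linjection n N A"
    and cyl: "cylinder_intersection {1..n} {1..n} {1..N} M"
    and sub: "M \<subseteq> {p \<in> {1..n} \<times> {1..n} \<times> {1..N}. linjection_fun A p = 1}"
  shows "edge_disjoint_triangles {1..n} {1..n} {1..N} M"
proof
  have MA: "A (x, y) = b \<and> x \<in> {1..n} \<and> y \<in> {1..n} \<and> b \<in> {1..N}" if "(x, y, b) \<in> M" for x y b
    using subsetD[OF sub that] by (simp add: linjection_fun_def split: if_splits)
  show "M \<subseteq> {1..n} \<times> {1..n} \<times> {1..N}" using sub by auto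
  show "x = x'" if "(x, y, b) \<in> M" "(x', y, b) \<in> M" for x x' y b
    using MA[OF that(1)] MA[OF that(2)] lin unfolding linjection_def inj_on_def by blast
  show "y = y'" if "(x, y, b) \<in> M" "(x, y', b) \<in> M" for x y y' b
    using MA[OF that(1)] MA[OF that(2)] lin unfolding linjection_def inj_on_def by blast
  show "b = b'" if "(x, y, b) \<in> M" "(x, y, b') \<in> M" for x y b b'
    using MA[OF that(1)] MA[OF that(2)] by simp
  obtain T1 T2 T3 where T: "cylinder1 {1..n} {1..n} {1..N} T1" "cylinder2 {1..n} {1..n} {1..N} T2"
      "cylinder3 {1..n} {1..n} {1..N} T3" and M: "M = T1 \<inter> T2 \<inter> T3"
    using cyl unfolding cylinder_intersection_def by blast
  show "(x, y, b) \<in> M" if "(x, y, b') \<in> M" "(x, y', b) \<in> M" "(x', y, b) \<in> M" for x x' y y' b b'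
  proof -
    have "x \<in> {1..n}" "y \<in> {1..n}" "b \<in> {1..N}" using MA that by blast+
    moreover have "(x, y, b') \<in> T3" "(x, y', b) \<in> T2" "(x', y, b) \<in> T1" using that M by auto
    ultimately have "(x, y, b) \<in> T3" "(x, y, b) \<in> T2" "(x, y, b) \<in> T1"
      using T unfolding cylinder1_def cylinder2_def cylinder3_def by blast+
    then show ?thesis using M by simp
  qed
qed auto

lemma alpha3_attained:
  obtains M where "cylinder_intersection {1..n} {1..n} {1..N} M"
    "M \<subseteq> {p \<in> {1..n} \<times> {1..n} \<times> {1..N}. linjection_fun A p = 1}" "alpha3 n N A = card M"
proof -
  let ?P = "\<lambda>S. cylinder_intersection {1..n} {1..n} {1..N} S
    \<and> S \<subseteq> {p \<in> {1..n} \<times> {1..n} \<times> {1..N}. linjection_fun A p = 1}"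
  let ?C = "{card S |S. ?P S}"
  have "finite (card ` Pow ({1..n} \<times> {1..n} \<times> {1..N}))" by simp
  then have "finite ?C" by (rule rev_finite_subset) blast
  moreover have "?P {}"
    by (auto simp: cylinder_intersection_def cylinder1_def cylinder2_def cylinder3_def)
  then have "?C \<noteq> {}" by blast
  ultimately have "Max ?C \<in> ?C" by (rule Max_in)
  then show ?thesis using that unfolding alpha3_def alpha3_fun_def by blast
qed

theorem theorem32:
  shows "\<exists>c C :: real. c > 0 \<and> C > 0 \<and>
    (\<forall>(n::nat) (N::nat) (A :: nat \<times> nat \<Rightarrow> nat).
       n > 0 \<longrightarrow> N > 0 \<longrightarrow>
       real N \<le> real n * 2 powr (c * real (log_star (real n))) \<longrightarrow>
       linjection n N A \<longrightarrow>
       real (alpha3 n N A) \<le> C * (real n ^ 2 / 2 powr (c * real (log_star (real n)))))"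
proof (intro exI conjI allI impI)
  \<comment> \<open>Since 576 * 2 / 9216 = 1/8, about \<open>L / 8\<close> increments suffice for
    \<open>\<delta> = 1 / q ^ 2\<close>. The constant \<open>2 ^ 24\<close> makes the range
    \<open>L \<le> 24\<close> trivial, because \<open>q \<le> 2 ^ L\<close>.\<close>
  show "(0::real) < 1 / 9216" "(0::real) < 2 ^ 24" by simp_all
  fix n N :: nat and A :: "nat \<times> nat \<Rightarrow> nat"
  assume n: "n > 0" and N: "N > 0" and lin: "linjection n N A"
    and NL: "real N \<le> real n * 2 powr (1 / 9216 * real (log_star (real n)))"
  define L where "L = log_star (real n)"
  define q where "q = 2 powr (1 / 9216 * real L)"
  have q1: "1 \<le> q" unfolding q_def by (simp add: ge_one_powr_ge_zero)
  have Nq: "real N \<le> real n * q" using NL by (simp add: q_def L_def)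
  have q_le: "q \<le> 2 ^ L"
  proof -
    have "q \<le> 2 powr real L" unfolding q_def by (intro powr_mono) auto
    then show ?thesis by (simp add: powr_realpow)
  qed
  obtain M where cyl: "cylinder_intersection {1..n} {1..n} {1..N} M"
      and sub: "M \<subseteq> {p \<in> {1..n} \<times> {1..n} \<times> {1..N}. linjection_fun A p = 1}"
      and alpha: "alpha3 n N A = card M"
    by (rule alpha3_attained)
  interpret edge_disjoint_triangles "{1..n}" "{1..n}" "{1..N}" M
    by (rule linjection_edge_disjoint_triangles[OF lin cyl sub])
  have "real (card M) \<le> 2 ^ 24 * (real n ^ 2 / q)"
  proof (cases "L \<le> 24")
    case True
    have "card M \<le> card ({1..n} \<times> {1..n})"
      using card_mono[OF _ XY_subset] card_edges(1) by simp
    then have "real (card M) \<le> real (n * n)" by (simp only: of_nat_le_iff) simp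
    then have "real (card M) \<le> real n ^ 2" by (simp add: power2_eq_square)
    moreover have "q \<le> 2 ^ 24"
      using q_le power_increasing[OF True, of "2::real"] by simp
    then have "real n ^ 2 * q \<le> real n ^ 2 * 2 ^ 24" by (intro mult_left_mono) auto
    then have "real n ^ 2 \<le> 2 ^ 24 * (real n ^ 2 / q)"
      using q1 by (simp add: field_simps)
    ultimately show ?thesis by linarith
  next
    case False
    then have L: "24 < L" by simp
    show ?thesis
    proof (rule ccontr)
      assume "\<not> real (card M) \<le> 2 ^ 24 * (real n ^ 2 / q)"
      moreover have "1 * (real n ^ 2 / q) \<le> 2 ^ 24 * (real n ^ 2 / q)"
        using q1 by (intro mult_right_mono) auto
      ultimately have big: "real n ^ 2 / q < real (card M)" by linarith
      \<comment> \<open>More than n^2 / q triangles have density at least 1 / q^2 even in the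
        largest of the three products, whose size is at most n^2 q.\<close>
      define \<delta> where "\<delta> = 1 / q ^ 2"
      \<comment> \<open>\<open>tower h\<close> reaches
        \<open>128 / \<delta>\<^sup>2 = 128 * q ^ 4\<close>, while \<open>h + 2 * s\<close> stays
        near 3/4 of \<open>L\<close>.\<close>
      define h where "h = L div 2"
      define s where "s = L div 8 + 1"
      have d: "0 < \<delta>" using q1 by (simp add: \<delta>_def)
      have "\<delta> * real (card ({1..n} \<times> {1..N})) \<le> \<delta> * (real n * (real n * q))"
        using d Nq by (simp add: card_cartesian_product mult_left_mono)
      also have "\<dots> = real n ^ 2 / q"
        using q1 by (simp add: \<delta>_def power2_eq_square)
      finally have dXB: "\<delta> * real (card ({1..n} \<times> {1..N})) \<le> real (card M)" using big by linarith
      have "\<delta> * real (card ({1..n} \<times> {1..n})) \<le> \<delta> * real (card ({1..n} \<times> {1..N}))"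
        using d lin by (simp add: card_cartesian_product linjection_def mult_left_mono)
      then have dXY: "\<delta> * real (card ({1..n} \<times> {1..n})) \<le> real (card M)" using dXB by linarith
      have "0 < real n ^ 2 / q" using n q1 by simp
      then have m: "card M > 0" using big by (cases "card M") auto
      have h5: "5 \<le> h" using L by (simp add: h_def)
      have h4: "4 \<le> tower h" by (rule four_le_tower[OF h5])
      have "128 / \<delta>\<^sup>2 = 128 * q ^ 4" by (simp add: \<delta>_def power_divide flip: power_mult)
      also have "q ^ 4 = 2 powr (1 / 2304 * real L)"
        by (simp add: q_def powr_power)
      also have "\<dots> \<le> 2 powr real L" by (intro powr_mono) auto
      also have "2 powr real L = 2 ^ L" by (simp add: powr_realpow)
      also have "128 * 2 ^ L = (2::real) ^ (L + 7)" by (simp add: power_add)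
      also have "\<dots> \<le> 2 ^ (2 * h + 9)" by (intro power_increasing) (auto simp: h_def)
      also have "\<dots> = real (2 ^ (2 * h + 9))" by simp
      also have "\<dots> \<le> real (tower h)" using tower_ge_power[OF h5] by (simp only: of_nat_le_iff)
      finally have h128: "128 / \<delta>\<^sup>2 \<le> real (tower h)" by simp
      have "ln (1 / \<delta>) = 2 * (1 / 9216 * real L * ln 2)"
        using q1 by (simp add: \<delta>_def ln_realpow) (simp add: q_def ln_powr)
      then have "576 * ln (1 / \<delta>) = real L / 8 * ln 2" by simp
      also have "\<dots> \<le> real L / 8 * 1" using ln_2_le by (intro mult_left_mono) auto
      also have "\<dots> < real s" unfolding s_def by linarith
      finally have s: "576 * ln (1 / \<delta>) < real s" .
      have "card M < 32 * tower (h + 2 * s) * n"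
        using card_triangles_less[OF d dXY dXB dXB m h4 h128 s] by simp
      then have "real (card M) < real (32 * tower (h + 2 * s) * n)"
        by (simp only: of_nat_less_iff)
      \<comment> \<open>Even after multiplication by \<open>q \<le> 2 ^ L\<close> the factor in
        front of \<open>n\<close> is at most \<open>tower (L - 1)\<close>, which is below
        \<open>n\<close>; this contradicts \<open>big\<close>.\<close>
      then have "real (card M) * q < real (32 * tower (h + 2 * s) * n) * q"
        by (rule mult_strict_right_mono) (use q1 in linarith)
      also have "\<dots> \<le> real (32 * tower (h + 2 * s) * n) * 2 ^ L"
        using q_le by (intro mult_left_mono) auto
      also have "\<dots> = real (32 * tower (h + 2 * s) * 2 ^ L) * real n" by simp
      also have "\<dots> \<le> real (tower (L - 1)) * real n"
      proof (rule mult_right_mono)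
        show "real (32 * tower (h + 2 * s) * 2 ^ L) \<le> real (tower (L - 1))"
          using tower_size_bound[OF L] unfolding h_def s_def of_nat_le_iff .
      qed simp
      also have "\<dots> \<le> real n * real n"
        using tower_less_of_log_star[of "L - 1" "real n"] L
        by (intro mult_right_mono) (auto simp: L_def)
      finally have "real (card M) * q < real n ^ 2" by (simp add: power2_eq_square)
      then show False using big q1 by (simp add: field_simps)
    qed
  qed
  then show "real (alpha3 n N A) \<le> 2 ^ 24 * (real n ^ 2 / 2 powr (1 / 9216 * real (log_star (real n))))"
    by (simp add: alpha q_def L_def)
qed

end
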